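(* Let $G$ be a nut graph of order $n$ such that $\mathrm{Aut}(G)$ has precisely two orbits on $V(G)$. Then $n$ is not a prime number.
   Context: A nut graph is a simple connected graph whose adjacency matrix has one-dimensional kernel spanned by a vector with no zero entry. $\mathrm{Aut}(G)$ is the full automorphism group of $G$. *)

theory Defs
  imports
    "HOL-Analysis.Analysis"
    "HOL-Algebra.Bij"
    "HOL-Algebra.Group_Action"
    "HOL-Computational_Algebra.Primes"
    "Graph_Theory.Graph_Theory"
begin

text \<open>
  An undirected edge \<open>uv\<close> of a simple graph is represented by the two arcs \<open>(u, v)\<close> and \<open>(v, u)\<close>;
  the locale predicate \<open>pair_graph\<close> says that the digraph is finite, loopless and symmetric.
  Vectors and matrices are indexed by the vertices themselves, so the vertex set of a nut graph is a
  whole finite type.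
\<close>

definition adj_matrix :: "'v::finite pair_pre_digraph \<Rightarrow> real^'v^'v" where
  "adj_matrix G = (\<chi> u v. if (u, v) \<in> parcs G then 1 else 0)"

definition mat_kernel :: "real^'n^'m \<Rightarrow> (real^'n) set" where
  "mat_kernel A = {x. A *v x = 0}"

text \<open>
  The qualified name \<open>Digraph_Component.connected\<close> is graph connectivity, as opposed to topological
  connectedness.
\<close>

definition nut_graph :: "'v::finite pair_pre_digraph \<Rightarrow> bool" where
  "nut_graph G \<longleftrightarrow>
     pair_graph G \<and> pverts G = UNIV \<and>
     Digraph_Component.connected (with_proj G) \<and>
     dim (mat_kernel (adj_matrix G)) = 1 \<and>
     (\<exists>x. mat_kernel (adj_matrix G) = span {x} \<and> (\<forall>v. x $ v \<noteq> 0))"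

definition automorphisms :: "'v pair_pre_digraph \<Rightarrow> ('v \<Rightarrow> 'v) set" where
  "automorphisms G =
     {f \<in> Bij (pverts G). \<forall>u\<in>pverts G. \<forall>v\<in>pverts G. (f u, f v) \<in> parcs G \<longleftrightarrow> (u, v) \<in> parcs G}"

definition Aut :: "'v pair_pre_digraph \<Rightarrow> ('v \<Rightarrow> 'v) monoid" where
  "Aut G = (BijGroup (pverts G)) \<lparr>carrier := automorphisms G\<rparr>"

lemma subgroup_automorphisms: "subgroup (automorphisms G) (BijGroup (pverts G))"
proof -
  interpret B: group "BijGroup (pverts G)" by (rule group_BijGroup)
  show ?thesis
  proof (rule B.subgroupI)
    show "automorphisms G \<subseteq> carrier (BijGroup (pverts G))"
      by (auto simp: automorphisms_def BijGroup_def)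
    have "(\<lambda>v\<in>pverts G. v) \<in> automorphisms G"
      by (auto simp: automorphisms_def id_Bij)
    then show "automorphisms G \<noteq> {}" by blast
  next
    fix f assume f: "f \<in> automorphisms G"
    then have fB: "f \<in> Bij (pverts G)" by (simp add: automorphisms_def)
    let ?g = "\<lambda>v\<in>pverts G. inv_into (pverts G) f v"
    have im: "f ` pverts G = pverts G" using fB by (simp add: Bij_def bij_betw_def)
    have gB: "?g \<in> Bij (pverts G)" by (rule restrict_inv_into_Bij[OF fB])
    have "(?g u, ?g v) \<in> parcs G \<longleftrightarrow> (u, v) \<in> parcs G"
      if uv: "u \<in> pverts G" "v \<in> pverts G" for u v
    proof -
      have "inv_into (pverts G) f u \<in> pverts G" "inv_into (pverts G) f v \<in> pverts G"
        using uv im by (auto intro: inv_into_into)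
      moreover have "f (inv_into (pverts G) f u) = u" "f (inv_into (pverts G) f v) = v"
        using uv im by (auto intro: f_inv_into_f)
      moreover have "(f u', f v') \<in> parcs G \<longleftrightarrow> (u', v') \<in> parcs G"
        if "u' \<in> pverts G" "v' \<in> pverts G" for u' v'
        using f that by (auto simp: automorphisms_def)
      ultimately show ?thesis using uv by (metis restrict_apply')
    qed
    with gB have "?g \<in> automorphisms G" by (simp add: automorphisms_def)
    then show "inv\<^bsub>BijGroup (pverts G)\<^esub> f \<in> automorphisms G"
      using inv_BijGroup[OF fB] by simp
  next
    fix f g assume fg: "f \<in> automorphisms G" "g \<in> automorphisms G"
    then have "f \<in> Bij (pverts G)" "g \<in> Bij (pverts G)" by (auto simp: automorphisms_def)
    moreover have "g v \<in> pverts G" if "v \<in> pverts G" for v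
      using \<open>g \<in> Bij (pverts G)\<close> that by (rule Bij_imp_funcset[THEN funcset_mem])
    ultimately show "f \<otimes>\<^bsub>BijGroup (pverts G)\<^esub> g \<in> automorphisms G"
      using fg by (simp add: automorphisms_def BijGroup_def compose_Bij compose_eq)
  qed
qed

lemma group_Aut: "group (Aut G)"
  unfolding Aut_def
  by (rule subgroup.subgroup_is_group[OF subgroup_automorphisms group_BijGroup])

lemma group_action_Aut: "group_action (Aut G) (pverts G) (\<lambda>f. f)"
proof -
  have "(\<lambda>f. f) \<in> hom (Aut G) (BijGroup (pverts G))"
    by (auto simp: hom_def Aut_def automorphisms_def BijGroup_def)
  then show ?thesis
    by (simp add: group_action_def group_hom_def group_hom_axioms_def group_BijGroup group_Aut)
qed

end

theory Submission
  imports Defs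
begin

text \<open>
  The two orbits \<open>U\<close> and \<open>W\<close> form an equitable partition. Double counting the edges between them
  gives \<open>|U| k = |W| l\<close>, and \<open>|U|\<close>, \<open>|W|\<close> are coprime because their sum is prime; as \<open>k \<le> |W|\<close>, either
  there are no edges between \<open>U\<close> and \<open>W\<close>, contradicting connectedness, or \<open>G\<close> is the join of the
  two regular graphs induced on \<open>U\<close> and \<open>W\<close>. In the latter case, summing the kernel equations over
  \<open>U\<close> and over \<open>W\<close> gives a homogeneous linear system for the sums of a kernel vector over
  \<open>U\<close> and \<open>W\<close>; its determinant is nonzero since the degrees inside \<open>U\<close> and \<open>W\<close> are less than
  \<open>|U|\<close> and \<open>|W|\<close>. Hence both sums vanish, and setting the vector to zero on \<open>W\<close> yields another
  kernel vector, contradicting the form of the kernel of a nut graph.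
\<close>

definition degree_into :: "'v pair_pre_digraph \<Rightarrow> 'v \<Rightarrow> 'v set \<Rightarrow> nat" where
  "degree_into G u W = card {w \<in> W. (u, w) \<in> parcs G}"

lemma carrier_Aut [simp]: "carrier (Aut G) = automorphisms G"
  by (simp add: Aut_def)

text \<open>Transitivity of the orbit relation keeps \<open>f\<close> inside \<open>W\<close>; being
  injective on a finite set, \<open>f\<close> is then onto \<open>W\<close>.\<close>

lemma automorphism_image_orbit:
  assumes f: "f \<in> automorphisms G" and W: "W \<in> orbits (Aut G) (pverts G) (\<lambda>f. f)"
    and fin: "finite (pverts G)"
  shows "f ` W = W"
proof -
  interpret A: group_action "Aut G" "pverts G" "\<lambda>f. f" by (rule group_action_Aut)
  obtain x where x: "x \<in> pverts G" and W_def: "W = Group_Action.orbit (Aut G) (\<lambda>f. f) x"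
    using W by (auto simp: orbits_def)
  have sub: "W \<subseteq> pverts G" using W A.orbits_coverture by blast
  have "f w \<in> W" if "w \<in> W" for w
  proof -
    have "f w \<in> pverts G" using A.element_image[of f w] f sub that by auto
    moreover have "f w \<in> Group_Action.orbit (Aut G) (\<lambda>f. f) w" 
      using f unfolding Group_Action.orbit_def by simp blast
    ultimately show ?thesis
      using A.orbit_trans[OF x, of w "f w"] that sub unfolding W_def by blast
  qed
  moreover have "inj_on f W" using A.inj_prop[of f] f sub by (auto intro: inj_on_subset)
  moreover have "finite W" using sub fin by (rule finite_subset)
  ultimately show ?thesis by (intro endo_inj_surj) auto
qed

text \<open>This is what makes the orbit partition equitable: an automorphism taking
  \<open>u\<close> to \<open>v\<close> preserves \<open>W\<close> setwise, so it carries the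
  neighbours of \<open>u\<close> in \<open>W\<close> bijectively onto those of
  \<open>v\<close>.\<close>

lemma degree_into_orbit_eq:
  assumes fin: "finite (pverts G)"
    and U: "U \<in> orbits (Aut G) (pverts G) (\<lambda>f. f)" and W: "W \<in> orbits (Aut G) (pverts G) (\<lambda>f. f)"
    and "u \<in> U" "v \<in> U"
  shows "degree_into G u W = degree_into G v W"
proof -
  interpret A: group_action "Aut G" "pverts G" "\<lambda>f. f" by (rule group_action_Aut)
  have sub: "U \<subseteq> pverts G" "W \<subseteq> pverts G" using U W A.orbits_coverture by blast+
  obtain x where x: "x \<in> pverts G" "U = Group_Action.orbit (Aut G) (\<lambda>f. f) x"
    using U by (auto simp: orbits_def)
  have "v \<in> Group_Action.orbit (Aut G) (\<lambda>f. f) u"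
    using A.orbit_trans[of u x v] A.orbit_sym[of x u] x \<open>u \<in> U\<close> \<open>v \<in> U\<close> sub by blast
  then obtain f where f: "f \<in> automorphisms G" "v = f u"
    unfolding Group_Action.orbit_def by simp blast
  have im: "f ` W = W" by (rule automorphism_image_orbit[OF f(1) W fin])
  have edge: "(f u, f w) \<in> parcs G \<longleftrightarrow> (u, w) \<in> parcs G" if "w \<in> W" for w
    using f(1) that sub \<open>u \<in> U\<close> by (auto simp: automorphisms_def)
  have "{w \<in> W. (v, w) \<in> parcs G} = {w \<in> f ` W. (f u, w) \<in> parcs G}"
    by (simp only: im f(2))
  also have "\<dots> = f ` {w \<in> W. (u, w) \<in> parcs G}"
    using edge by auto
  finally have "{w \<in> W. (v, w) \<in> parcs G} = f ` {w \<in> W. (u, w) \<in> parcs G}" .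
  moreover have "inj_on f {w \<in> W. (u, w) \<in> parcs G}"
    by (rule inj_on_subset[OF A.inj_prop[of f]]) (use f sub in auto)
  ultimately show ?thesis by (simp add: degree_into_def card_image)
qed

lemma pair_graph_sym: "pair_graph G \<Longrightarrow> (u, v) \<in> parcs G \<longleftrightarrow> (v, u) \<in> parcs G"
  using pair_sym_digraph.pair_sym_arcs[of G] pair_graph_def[of G] pair_pseudo_graph_def[of G]
  by (auto simp: symmetric_def sym_def)

lemma pair_graph_irrefl: "pair_graph G \<Longrightarrow> (u, u) \<notin> parcs G"
  using pair_loopfree_digraph.pair_no_loops[of G "(u, u)"] pair_graph_def[of G]
    pair_digraph_def[of G]
  by auto

lemma degree_into_le: "finite W \<Longrightarrow> degree_into G u W \<le> card W"
  unfolding degree_into_def by (rule card_mono) auto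

lemma degree_into_less:
  assumes "pair_graph G" "finite U" "u \<in> U"
  shows "degree_into G u U < card U"
  unfolding degree_into_def
  by (rule psubset_card_mono) (use assms pair_graph_irrefl[OF assms(1), of u] in auto)

lemma double_count_degree_into:
  assumes G: "pair_graph G" and fin: "finite U" "finite W"
    and k: "\<And>u. u \<in> U \<Longrightarrow> degree_into G u W = k" and l: "\<And>w. w \<in> W \<Longrightarrow> degree_into G w U = l"
  shows "card U * k = card W * l"
proof -
  have "(\<Sum>u\<in>U. degree_into G u W) = (\<Sum>w\<in>W. l)"
    unfolding degree_into_def
    by (rule sum_multicount_gen[OF fin])
      (use l pair_graph_sym[OF G] in \<open>auto simp: degree_into_def\<close>)
  then show ?thesis using k by simp
qed

text \<open>Without such an arc, a path starting in \<open>U\<close> could never leave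
  \<open>U\<close>. Paths run in the symmetric closure of the arcs, hence the two
  orientations.\<close>

lemma connected_crossing_arc:
  assumes conn: "Digraph_Component.connected (with_proj G)"
    and sub: "U \<subseteq> pverts G" "W \<subseteq> pverts G" "U \<noteq> {}" "W \<noteq> {}" and cover: "U \<union> W = pverts G"
    and disj: "U \<inter> W = {}"
  shows "\<exists>u\<in>U. \<exists>w\<in>W. (u, w) \<in> parcs G \<or> (w, u) \<in> parcs G"
proof (rule ccontr)
  assume none: "\<not> ?thesis"
  obtain u w where uw: "u \<in> U" "w \<in> W" using sub by blast
  have "(u, w) \<in> rtrancl_on (pverts G) ((parcs G)\<^sup>s)"
    using conn uw sub by (auto simp: connected_conv)
  then have "w \<in> U"
  proof (induction rule: rtrancl_on_induct)
    case (step y z)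
    then show ?case using none cover by (auto simp: symcl_def)
  qed (use uw in auto)
  with uw disj show False by blast
qed

lemma mat_kernel_adj_matrix_iff:
  "x \<in> mat_kernel (adj_matrix G) \<longleftrightarrow> (\<forall>u. (\<Sum>w | (u, w) \<in> parcs G. x $ w) = 0)"
proof -
  have "(adj_matrix G *v x) $ u = (\<Sum>w | (u, w) \<in> parcs G. x $ w)" for u
    by (simp add: matrix_vector_mult_def adj_matrix_def if_distrib[of "\<lambda>c. c * _"] sum.If_cases cong: if_cong)
  then show ?thesis by (simp add: mat_kernel_def vec_eq_iff)
qed

text \<open>After exchanging the sums, each \<open>x $ w\<close> is counted once per neighbour of
  \<open>w\<close> in \<open>U\<close>, that is, \<open>k\<close> times.\<close>

lemma sum_nbrs_regular:
  fixes x :: "real^'v::finite"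
  assumes G: "pair_graph G" and k: "\<And>u. u \<in> U \<Longrightarrow> degree_into G u U = k"
  shows "(\<Sum>u\<in>U. \<Sum>w | w \<in> U \<and> (u, w) \<in> parcs G. x $ w) = real k * (\<Sum>u\<in>U. x $ u)"
proof -
  have "(\<Sum>u\<in>U. \<Sum>w | w \<in> U \<and> (u, w) \<in> parcs G. x $ w)
      = (\<Sum>w\<in>U. \<Sum>u | u \<in> U \<and> (u, w) \<in> parcs G. x $ w)"
    by (rule sum.swap_restrict) auto
  also have "\<dots> = (\<Sum>w\<in>U. real (degree_into G w U) * x $ w)"
    using pair_graph_sym[OF G] by (auto simp: degree_into_def intro!: sum.cong)
  also have "\<dots> = real k * (\<Sum>u\<in>U. x $ u)"
    using k by (simp add: sum_distrib_left)
  finally show ?thesis .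
qed

lemma mat_kernel_join_restrict:
  fixes G :: "'v::finite pair_pre_digraph"
  assumes G: "pair_graph G" and cover: "U \<union> W = UNIV" and disj: "U \<inter> W = {}"
    and ne: "U \<noteq> {}" "W \<noteq> {}"
    and k: "\<And>u. u \<in> U \<Longrightarrow> degree_into G u U = k" and l: "\<And>w. w \<in> W \<Longrightarrow> degree_into G w W = l"
    and join: "\<And>u w. u \<in> U \<Longrightarrow> w \<in> W \<Longrightarrow> (u, w) \<in> parcs G"
    and x: "x \<in> mat_kernel (adj_matrix G)"
  shows "(\<chi> v. if v \<in> U then x $ v else 0) \<in> mat_kernel (adj_matrix G)"
proof -
  have join': "(w, u) \<in> parcs G" if "u \<in> U" "w \<in> W" for u w
    using join[OF that] pair_graph_sym[OF G] by blast
  define s where "s = (\<Sum>u\<in>U. x $ u)"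
  define t where "t = (\<Sum>w\<in>W. x $ w)"
  have nbrsU: "{v. (u, v) \<in> parcs G} = {v. v \<in> U \<and> (u, v) \<in> parcs G} \<union> W" if "u \<in> U" for u
    using that join cover by auto
  have nbrsW: "{v. (w, v) \<in> parcs G} = {v. v \<in> W \<and> (w, v) \<in> parcs G} \<union> U" if "w \<in> W" for w
    using that join' cover by auto
  \<comment> \<open>Every vertex of \<open>U\<close> sees all of \<open>W\<close>, so
    \<open>W\<close> contributes the same total \<open>t\<close> to each kernel equation on
    \<open>U\<close>.\<close>
  have eqU: "(\<Sum>v | v \<in> U \<and> (u, v) \<in> parcs G. x $ v) = - t" if "u \<in> U" for u
  proof -
    have "(\<Sum>v | (u, v) \<in> parcs G. x $ v) = (\<Sum>v | v \<in> U \<and> (u, v) \<in> parcs G. x $ v) + t"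
      unfolding nbrsU[OF that] t_def by (rule sum.union_disjoint) (use disj in auto)
    then show ?thesis using x by (simp add: mat_kernel_adj_matrix_iff)
  qed
  have eqW: "(\<Sum>v | v \<in> W \<and> (w, v) \<in> parcs G. x $ v) = - s" if "w \<in> W" for w
  proof -
    have "(\<Sum>v | (w, v) \<in> parcs G. x $ v) = (\<Sum>v | v \<in> W \<and> (w, v) \<in> parcs G. x $ v) + s"
      unfolding nbrsW[OF that] s_def by (rule sum.union_disjoint) (use disj in auto)
    then show ?thesis using x by (simp add: mat_kernel_adj_matrix_iff)
  qed
  have 1: "real k * s = - (real (card U) * t)"
    using sum_nbrs_regular[OF G k, where x = x] eqU by (simp add: s_def)
  have 2: "real l * t = - (real (card W) * s)"
    using sum_nbrs_regular[OF G l, where x = x] eqW by (simp add: t_def)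
  have "k < card U" "l < card W"
    using ne k l degree_into_less[OF G, of U] degree_into_less[OF G, of W] by fastforce+
  then have "k * l < card U * card W"
    using le_less_trans[OF le0 \<open>k < card U\<close>] by (intro mult_strict_mono) simp_all
  then have det: "real k * real l - real (card U) * real (card W) \<noteq> 0"
    by (metis of_nat_less_iff of_nat_mult less_irrefl right_minus_eq)
  \<comment> \<open>Eliminate \<open>t\<close>: multiply the first equation by \<open>l\<close> and
    the second by \<open>card U\<close>.\<close>
  have "(real k * real l - real (card U) * real (card W)) * s = 0"
    using arg_cong[OF 1, of "\<lambda>z. real l * z"] arg_cong[OF 2, of "\<lambda>z. real (card U) * z"]
    by (simp add: algebra_simps)
  then have s: "s = 0" using det by simp
  then have t: "t = 0" using 1 ne(1) by simp
  have "(\<Sum>v | (u, v) \<in> parcs G. if v \<in> U then x $ v else 0) = 0" for u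
  proof -
    have "(\<Sum>v | (u, v) \<in> parcs G. if v \<in> U then x $ v else 0)
        = (\<Sum>v | v \<in> U \<and> (u, v) \<in> parcs G. x $ v)"
      by (simp add: sum.If_cases Collect_conj_eq Int_commute)
    also have "\<dots> = 0"
    \<comment> \<open>For \<open>u\<close> in \<open>U\<close> the sum is \<open>- t\<close>; for
      \<open>u\<close> in \<open>W\<close> it runs over all of \<open>U\<close> and equals
      \<open>s\<close>. Both vanish.\<close>
    proof (cases "u \<in> U")
      case True
      then show ?thesis using eqU t by simp
    next
      case False
      then have "u \<in> W" using cover by auto
      then have "{v. v \<in> U \<and> (u, v) \<in> parcs G} = U" using join' by auto
      then show ?thesis using s s_def by simp
    qed
    finally show ?thesis .
  qed
  then show ?thesis by (simp add: mat_kernel_adj_matrix_iff)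
qed

text \<open>A kernel vector is a multiple of a nowhere-zero vector, so a single nonzero entry forces
  a nonzero scalar.\<close>

lemma nut_graph_kernel_support:
  assumes "nut_graph G" and y: "y \<in> mat_kernel (adj_matrix G)" and "y $ u \<noteq> 0"
  shows "y $ v \<noteq> 0"
proof -
  obtain x where "mat_kernel (adj_matrix G) = span {x}" and x: "\<forall>v. x $ v \<noteq> 0"
    using assms(1) by (auto simp: nut_graph_def)
  then obtain c where "y = c *\<^sub>R x" using y by (auto simp: span_singleton)
  then show ?thesis using x assms(3) by auto
qed

theorem theorem19:
  fixes G :: "'v::finite pair_pre_digraph" and n :: nat
  assumes "nut_graph G"
    and "card (pverts G) = n"
    and "card (orbits (Aut G) (pverts G) (\<lambda>f. f)) = 2"
  shows "\<not> prime n"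
proof
  assume prime: "prime n"
  have G: "pair_graph G" and V: "pverts G = UNIV"
    and conn: "Digraph_Component.connected (with_proj G)"
    using assms(1) by (auto simp: nut_graph_def)
  let ?O = "orbits (Aut G) (pverts G) (\<lambda>f. f)"
  interpret A: group_action "Aut G" "pverts G" "\<lambda>f. f" by (rule group_action_Aut)
  obtain U W where O: "?O = {U, W}" "U \<noteq> W" using assms(3) by (auto simp: card_2_iff)
  have cover: "U \<union> W = UNIV" using A.orbits_coverture O V by auto
  have disj: "U \<inter> W = {}" using A.disjoint_union[of U W] O by auto
  have ne: "U \<noteq> {}" "W \<noteq> {}" using O A.orbit_refl by (auto simp: orbits_def)
  then obtain u w where uw: "u \<in> U" "w \<in> W" by blast
  have UO: "U \<in> ?O" and WO: "W \<in> ?O" using O by auto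
  have fin: "finite (pverts G)" by simp
  note const = degree_into_orbit_eq[OF fin]
  define k where "k = degree_into G u W"
  define l where "l = degree_into G w U"
  have k: "degree_into G v W = k" if "v \<in> U" for v
    unfolding k_def by (rule const[OF UO WO that uw(1)])
  have l: "degree_into G v U = l" if "v \<in> W" for v
    unfolding l_def by (rule const[OF WO UO that uw(2)])
  have count: "card U * k = card W * l"
    by (rule double_count_degree_into[OF G _ _ k l]) auto
  have n: "n = card U + card W"
    using card_Un_disjoint[OF _ _ disj] cover V assms(2) by simp
  have pos: "card U > 0" "card W > 0" using ne by (auto simp: card_gt_0_iff)
  \<comment> \<open>Since both parts are nonempty, \<open>0 < card U < n\<close>, so the prime
    \<open>n\<close> cannot divide \<open>card U\<close>.\<close>
  have "coprime (card U) n"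
    using prime n pos
    by (metis add.commute coprime_commute less_add_same_cancel2 nat_dvd_not_less prime_imp_coprime)
  then have "coprime (card W) (card U)" unfolding n by (subst coprime_commute) (simp only: coprime_iff_gcd_eq_1 gcd_add2)
  then have dvd: "card W dvd k"
    using count by (metis coprime_dvd_mult_right_iff dvd_triv_left)
  \<comment> \<open>Symmetry of the arcs lets the crossing arc be oriented from \<open>U\<close> to
    \<open>W\<close>.\<close>
  obtain a b where "a \<in> U" "b \<in> W" "(a, b) \<in> parcs G"
    using connected_crossing_arc[OF conn _ _ ne _ disj] cover V pair_graph_sym[OF G] by auto
  then have "degree_into G a W > 0" by (auto simp: degree_into_def card_gt_0_iff)
  then have "k > 0" using k \<open>a \<in> U\<close> by simp
  \<comment> \<open>A positive multiple of \<open>card W\<close> that is at most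
    \<open>card W\<close> equals it.\<close>
  then have kW: "k = card W"
    using dvd degree_into_le[of W G u] by (simp add: k_def dvd_imp_le le_antisym)
  have join: "(c, d) \<in> parcs G" if "c \<in> U" "d \<in> W" for c d
  proof -
    have "{v \<in> W. (c, v) \<in> parcs G} = W"
      by (rule card_subset_eq) (use k[OF that(1)] kW in \<open>auto simp: degree_into_def\<close>)
    then show ?thesis using that by blast
  qed
  obtain x where "mat_kernel (adj_matrix G) = span {x}" and x0: "\<forall>v. x $ v \<noteq> 0"
    using assms(1) by (auto simp: nut_graph_def)
  then have x: "x \<in> mat_kernel (adj_matrix G)" by (simp add: span_base)
  \<comment> \<open>This vector is nonzero at \<open>u\<close> but zero at \<open>w\<close>, which
    no kernel vector of a nut graph can be.\<close>
  let ?y = "\<chi> v. if v \<in> U then x $ v else 0"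
  have "?y \<in> mat_kernel (adj_matrix G)"
    by (rule mat_kernel_join_restrict[OF G cover disj ne
          const[OF UO UO _ uw(1)] const[OF WO WO _ uw(2)] join x])
  moreover have "?y $ u \<noteq> 0" "?y $ w = 0" using uw x0 disj by auto
  ultimately show False using nut_graph_kernel_support[OF assms(1)] by blast
qed

end
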